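(* Let $X$ be the space of all elements $\{a,b\}$ belonging to the $D$-locus in $A_5$ such that $a$ and $b$ are zero-divisors in $A_4$ with unit length. Let $\xi$ be the 4-plane bundle over the Stiefel manifold $V_2(\mathbb{R}^7)$ described in the context, whose unit sphere bundle has total space diffeomorphic to the 14-dimensional compact simply connected Lie group $G_2$. Then $X$ is diffeomorphic to the (total space of the) unit sphere bundle of $\xi\oplus 2$, where $\xi\oplus 2$ is the fiberwise sum of the vector bundle $\xi$ with the trivial 2-dimensional real vector bundle.
   Context: The Cayley-Dickson algebras $A_n$ are real algebras with involution defined inductively: $A_0=\mathbb{R}$ with trivial conjugation, and $A_n=A_{n-1}\times A_{n-1}$ additively, with $(a,b)^*=(a^*,-b)$ and $(a,b)(c,d)=(ac-d^*b,\;da+bc^* )$. For $n\ge 1$ put $i_n=(0,1)\in A_n$, and let $\mathbb{C}_n$ be the $\mathbb{R}$-linear span of $1=(1,0)$ and $i_n$. The real inner product is $\langle a,b\rangle_{\mathbb{R}}=\mathrm{Re}(ab^* )$, where $\mathrm{Re}(x)=\frac12(x+x^* )$, with norm (length) $|a|=\sqrt{aa^*}$; "orthogonal" refers to it. The Hermitian inner product $\langle a,b\rangle_{\mathbb{C}}$ is the orthogonal projection of $ab^*$ onto $\mathbb{C}_n$; $a,b$ are $\mathbb{C}$-orthogonal if $\langle a,b\rangle_{\mathbb{C}}=0$. $\mathbb{C}_n^\perp$ is the orthogonal complement of $\mathbb{C}_n$ in $A_n$. For $a,b\in\mathbb{C}_n^\perp$, $\{a,b\}$ denotes the element $\frac{1}{\sqrt2}\big(a+b,\;i_n(-a+b)\big)$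 of $A_{n+1}$. For $x\in A_m$, $\mathrm{Ann}(x)=\{y\in A_m: xy=0\}$. A zero-divisor is a non-zero $x$ for which there is a non-zero $y$ with $xy=0$; zero-divisors of $A_n$ lie in $\mathbb{C}_n^\perp$. The $D$-locus in $A_{n+1}$ is the space of all elements $\{a,b\}$ with $a,b\in\mathbb{C}_n^\perp$ such that (1) $a$ and $b$ are $\mathbb{C}$-orthogonal, (2) $a$ is orthogonal to $\mathrm{Ann}(b)$, and (3) $b$ is orthogonal to $\mathrm{Ann}(a)$ (annihilators taken in $A_n$). $V_2(\mathbb{R}^7)$ is the space of orthonormal 2-frames in $\mathbb{R}^7$, where $\mathbb{R}^7$ is the space of imaginary elements of $A_3$ (those with $\mathrm{Re}(x)=0$). It is identified with the space of elements $(a_1,a_2)$ of $A_4$ with $a_1,a_2$ orthogonal imaginary unit vectors in $A_3$, and (after rescaling) with the space of unit length zero-divisors in $A_4$: an element $(a_1,a_2)\in A_4$ is a zero-divisor if and only if $a_1,a_2$ are non-zero imaginary orthogonal elements of $A_3$ of the same norm, in which case its annihilator is 4-dimensional. The bundle $\xi$ is the 4-plane bundle over $V_2(\mathbb{R}^7)$ whose fiber over a zero-divisor $a$ is $\mathrm{Ann}(a)\subset A_4$. *)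

theory Defs
  imports "HOL-Analysis.Analysis"
begin

section \<open>Cayley-Dickson algebras\<close>

text \<open>
  \<^typ>\<open>real\<close> is the algebra \<open>A\<^sub>0\<close>, and the type constructor \<open>cd\<close> below is the doubling
  \<open>A\<^sub>n = A\<^sub>n\<^sub>-\<^sub>1 \<times> A\<^sub>n\<^sub>-\<^sub>1\<close>. The algebras are the instances of the class \<open>cayley_dickson\<close>, whose
  axioms are exactly what is needed to see, by induction on the doublings, that the Euclidean
  inner product and norm of the library are the ones obtained from the conjugation:
  \<open>\<langle>a,b\<rangle> = Re (a b\<^sup>*)\<close> and \<open>|a|\<^sup>2 = a a\<^sup>*\<close>, the real numbers being the multiples of \<open>1\<close>.
\<close>

class cayley_dickson = euclidean_space + times + one +
  fixes cdcnj :: "'a \<Rightarrow> 'a"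
  assumes cd_add_mult: "(x + y) * z = x * z + y * z"
    and cd_mult_add: "x * (y + z) = x * y + x * z"
    and cd_scaleR_mult: "(r *\<^sub>R x) * y = r *\<^sub>R (x * y)"
    and cd_mult_scaleR: "x * (r *\<^sub>R y) = r *\<^sub>R (x * y)"
    and cd_one_mult: "1 * x = x"
    and cd_mult_one: "x * 1 = x"
    and cdcnj_add: "cdcnj (x + y) = cdcnj x + cdcnj y"
    and cdcnj_scaleR: "cdcnj (r *\<^sub>R x) = r *\<^sub>R cdcnj x"
    and cdcnj_cdcnj: "cdcnj (cdcnj x) = x"
    and cdcnj_one: "cdcnj 1 = 1"
    and cdcnj_mult: "cdcnj (x * y) = cdcnj y * cdcnj x"
    and cd_inner_cdcnj: "inner (cdcnj x) (cdcnj y) = inner x y"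
    and cd_mult_cdcnj: "x * cdcnj y + cdcnj (x * cdcnj y) = (2 * inner x y) *\<^sub>R 1"

lemma cd_zero_mult [simp]: "0 * x = 0"
  for x :: "'a::cayley_dickson"
  using cd_scaleR_mult[of 0 "0 :: 'a" x] by simp

lemma cd_mult_zero [simp]: "x * 0 = 0"
  for x :: "'a::cayley_dickson"
  using cd_mult_scaleR[of x 0 0] by simp

lemma cdcnj_zero [simp]: "cdcnj 0 = (0 :: 'a::cayley_dickson)"
  using cdcnj_scaleR[of 0 "0 :: 'a"] by simp

lemma cd_minus_mult: "(- x) * y = - (x * y)"
  for x :: "'a::cayley_dickson"
  using cd_scaleR_mult[of "-1" x y] by simp

lemma cd_mult_minus: "x * (- y) = - (x * y)"
  for x :: "'a::cayley_dickson"
  using cd_mult_scaleR[of x "-1" y] by simp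

lemma cdcnj_minus: "cdcnj (- x) = - cdcnj x"
  for x :: "'a::cayley_dickson"
  using cdcnj_scaleR[of "-1" x] by simp

instantiation real :: cayley_dickson
begin

definition cdcnj_real :: "real \<Rightarrow> real" where "cdcnj_real x = x"

instance
  by standard (auto simp: cdcnj_real_def algebra_simps)

end

datatype 'a cd = CD (cd1: 'a) (cd2: 'a)

lemma cd_eq_iff: "x = y \<longleftrightarrow> cd1 x = cd1 y \<and> cd2 x = cd2 y"
  by (cases x; cases y) auto

instantiation cd :: (real_vector) real_vector
begin

definition "0 = CD 0 0"
definition "x + y = CD (cd1 x + cd1 y) (cd2 x + cd2 y)"
definition "x - y = CD (cd1 x - cd1 y) (cd2 x - cd2 y)"
definition "- x = CD (- cd1 x) (- cd2 x)"
definition "r *\<^sub>R x = CD (r *\<^sub>R cd1 x) (r *\<^sub>R cd2 x)"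

instance
  by standard
    (auto simp: zero_cd_def plus_cd_def minus_cd_def uminus_cd_def scaleR_cd_def algebra_simps)

end

lemma cd_sel_simps [simp]:
  "cd1 0 = 0" "cd2 0 = 0"
  "cd1 (x + y) = cd1 x + cd1 y" "cd2 (x + y) = cd2 x + cd2 y"
  "cd1 (x - y) = cd1 x - cd1 y" "cd2 (x - y) = cd2 x - cd2 y"
  "cd1 (- x) = - cd1 x" "cd2 (- x) = - cd2 x"
  "cd1 (r *\<^sub>R x) = r *\<^sub>R cd1 x" "cd2 (r *\<^sub>R x) = r *\<^sub>R cd2 x"
  by (simp_all add: zero_cd_def plus_cd_def minus_cd_def uminus_cd_def scaleR_cd_def)

instantiation cd :: (real_inner) real_inner
begin

definition inner_cd :: "'a cd \<Rightarrow> 'a cd \<Rightarrow> real"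
  where "inner_cd x y = inner (cd1 x) (cd1 y) + inner (cd2 x) (cd2 y)"

definition norm_cd :: "'a cd \<Rightarrow> real"
  where "norm_cd x = sqrt (inner x x)"

definition dist_cd :: "'a cd \<Rightarrow> 'a cd \<Rightarrow> real"
  where "dist_cd x y = norm (x - y)"

definition sgn_cd :: "'a cd \<Rightarrow> 'a cd"
  where "sgn_cd x = x /\<^sub>R norm x"

definition uniformity_cd :: "('a cd \<times> 'a cd) filter"
  where "uniformity_cd = (INF e\<in>{0<..}. principal {(x, y). dist x y < e})"

definition open_cd :: "'a cd set \<Rightarrow> bool"
  where "open_cd U \<longleftrightarrow> (\<forall>x\<in>U. eventually (\<lambda>(x', y). x' = x \<longrightarrow> y \<in> U) uniformity)"

instance
proof
  fix x y z :: "'a cd" and r :: real and U :: "'a cd set"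
  show "dist x y = norm (x - y)" by (simp add: dist_cd_def)
  show "sgn x = x /\<^sub>R norm x" by (simp add: sgn_cd_def)
  show "uniformity = (INF e\<in>{0<..}. principal {(x::'a cd, y). dist x y < e})"
    by (simp add: uniformity_cd_def)
  show "open U \<longleftrightarrow> (\<forall>x\<in>U. eventually (\<lambda>(x', y). x' = x \<longrightarrow> y \<in> U) uniformity)"
    by (simp add: open_cd_def)
  show "inner x y = inner y x" by (simp add: inner_cd_def inner_commute)
  show "inner (x + y) z = inner x z + inner y z" by (simp add: inner_cd_def inner_add_left)
  show "inner (r *\<^sub>R x) y = r * inner x y" by (simp add: inner_cd_def distrib_left)
  show "0 \<le> inner x x" by (simp add: inner_cd_def)
  show "inner x x = 0 \<longleftrightarrow> x = 0"
    by (simp add: inner_cd_def cd_eq_iff add_nonneg_eq_0_iff)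
  show "norm x = sqrt (inner x x)" by (simp add: norm_cd_def)
qed

end

instantiation cd :: (euclidean_space) euclidean_space
begin

definition Basis_cd :: "'a cd set"
  where "Basis_cd = (\<lambda>u. CD u 0) ` Basis \<union> (\<lambda>v. CD 0 v) ` Basis"

instance
proof
  show "(Basis :: 'a cd set) \<noteq> {}" by (simp add: Basis_cd_def)
  show "finite (Basis :: 'a cd set)" by (simp add: Basis_cd_def)
  fix u v x :: "'a cd"
  show "inner u v = (if u = v then 1 else 0)" if "u \<in> Basis" "v \<in> Basis"
    using that by (auto simp: Basis_cd_def inner_cd_def inner_Basis split: if_split_asm)
  show "(\<forall>u\<in>Basis. inner x u = 0) \<longleftrightarrow> x = 0"
    unfolding Basis_cd_def ball_Un ball_simps
    by (simp add: inner_cd_def cd_eq_iff euclidean_all_zero_iff)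
qed

end

instantiation cd :: (cayley_dickson) cayley_dickson
begin

definition one_cd :: "'a cd" where "1 = CD 1 0"

definition cdcnj_cd :: "'a cd \<Rightarrow> 'a cd"
  where "cdcnj x = CD (cdcnj (cd1 x)) (- cd2 x)"

definition times_cd :: "'a cd \<Rightarrow> 'a cd \<Rightarrow> 'a cd"
  where "x * y = CD (cd1 x * cd1 y - cdcnj (cd2 y) * cd2 x) (cd2 y * cd1 x + cd2 x * cdcnj (cd1 y))"

instance
proof
  fix x y z :: "'a cd" and r :: real
  note simps = one_cd_def cdcnj_cd_def times_cd_def cd_eq_iff
    cd_add_mult cd_mult_add cd_scaleR_mult cd_mult_scaleR cd_one_mult cd_mult_one
    cdcnj_add cdcnj_scaleR cdcnj_cdcnj cdcnj_one cdcnj_mult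
    cd_minus_mult cd_mult_minus cdcnj_minus
  show "(x + y) * z = x * z + y * z" by (simp add: simps algebra_simps)
  show "x * (y + z) = x * y + x * z" by (simp add: simps algebra_simps)
  show "(r *\<^sub>R x) * y = r *\<^sub>R (x * y)" by (simp add: simps algebra_simps)
  show "x * (r *\<^sub>R y) = r *\<^sub>R (x * y)" by (simp add: simps algebra_simps)
  show "1 * x = x" by (simp add: simps)
  show "x * 1 = x" by (simp add: simps)
  show "cdcnj (x + y) = cdcnj x + cdcnj y" by (simp add: simps)
  show "cdcnj (r *\<^sub>R x) = r *\<^sub>R cdcnj x" by (simp add: simps)
  show "cdcnj (cdcnj x) = x" by (simp add: simps)
  show "cdcnj 1 = (1 :: 'a cd)" by (simp add: simps)
  have cnj_diff: "cdcnj (a - b) = cdcnj a - cdcnj b" for a b :: 'a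
    using cdcnj_add[of a "- b"] by (simp add: cdcnj_minus)
  show "cdcnj (x * y) = cdcnj y * cdcnj x" by (simp add: simps cnj_diff)
  show "inner (cdcnj x) (cdcnj y) = inner x y"
    by (simp add: cdcnj_cd_def inner_cd_def cd_inner_cdcnj)
  have 1: "cd1 x * cdcnj (cd1 y) + cdcnj (cd1 x * cdcnj (cd1 y)) = (2 * inner (cd1 x) (cd1 y)) *\<^sub>R 1"
    by (rule cd_mult_cdcnj)
  have 2: "cdcnj (cd2 y) * cd2 x + cdcnj (cdcnj (cd2 y) * cd2 x) = (2 * inner (cd2 x) (cd2 y)) *\<^sub>R 1"
    using cd_mult_cdcnj[of "cdcnj (cd2 y)" "cdcnj (cd2 x)"]
    by (simp add: cdcnj_cdcnj cd_inner_cdcnj inner_commute)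
  have "cd1 (x * cdcnj y + cdcnj (x * cdcnj y)) =
      (cd1 x * cdcnj (cd1 y) + cdcnj (cd1 x * cdcnj (cd1 y))) +
      (cdcnj (cd2 y) * cd2 x + cdcnj (cdcnj (cd2 y) * cd2 x))"
    by (simp add: times_cd_def cdcnj_cd_def cdcnj_add cdcnj_minus cd_minus_mult)
  also have "\<dots> = (2 * inner x y) *\<^sub>R 1"
    unfolding 1 2 by (simp add: inner_cd_def algebra_simps)
  finally have "cd1 (x * cdcnj y + cdcnj (x * cdcnj y)) = (2 * inner x y) *\<^sub>R 1" .
  then show "x * cdcnj y + cdcnj (x * cdcnj y) = (2 * inner x y) *\<^sub>R 1"
    by (simp add: cd_eq_iff one_cd_def)
      (simp add: times_cd_def cdcnj_cd_def)
qed

end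

lemma times_CD: "CD a b * CD c d = CD (a * c - cdcnj d * b) (d * a + b * cdcnj c)"
  by (simp add: times_cd_def)

lemma cdcnj_CD: "cdcnj (CD a b) = CD (cdcnj a) (- b)"
  by (simp add: cdcnj_cd_def)

type_synonym A3 = "real cd cd cd"
type_synonym A4 = "A3 cd"
type_synonym A5 = "A4 cd"

definition cdRe :: "'a::cayley_dickson \<Rightarrow> 'a"
  where "cdRe x = (1 / 2) *\<^sub>R (x + cdcnj x)"

lemma cdRe_mult_cdcnj: "cdRe (a * cdcnj b) = inner a b *\<^sub>R 1"
  unfolding cdRe_def cd_mult_cdcnj by simp

lemma mult_cdcnj_self: "a * cdcnj a = (norm a)\<^sup>2 *\<^sub>R 1"
  for a :: "'a::cayley_dickson"
proof -
  have "2 *\<^sub>R (a * cdcnj a) = (2 * inner a a) *\<^sub>R 1"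
    using cd_mult_cdcnj[of a a] by (simp add: cdcnj_mult cdcnj_cdcnj scaleR_2)
  then have "(1 / 2) *\<^sub>R (2 *\<^sub>R (a * cdcnj a)) = (1 / 2) *\<^sub>R ((2 * inner a a) *\<^sub>R 1)"
    by (rule arg_cong)
  then show ?thesis by (simp add: power2_norm_eq_inner)
qed

section \<open>Zero-divisors and the D-locus\<close>

definition Ann :: "'a::cayley_dickson \<Rightarrow> 'a set"
  where "Ann x = {y. x * y = 0}"

definition zero_divisor :: "'a::cayley_dickson \<Rightarrow> bool"
  where "zero_divisor x \<longleftrightarrow> x \<noteq> 0 \<and> (\<exists>y. y \<noteq> 0 \<and> x * y = 0)"

definition cd_i :: "'a::cayley_dickson cd"
  where "cd_i = CD 0 1"

definition cd_C :: "'a::cayley_dickson cd set"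
  where "cd_C = span {1, cd_i}"

definition orth_proj :: "'a::euclidean_space set \<Rightarrow> 'a \<Rightarrow> 'a"
  where "orth_proj S x = (THE p. p \<in> S \<and> x - p \<in> S\<^sup>\<bottom>)"

lemma orth_proj_eqI:
  assumes "subspace S" "p \<in> S" "x - p \<in> S\<^sup>\<bottom>"
  shows "orth_proj S x = p"
  unfolding orth_proj_def
proof (rule the_equality)
  fix q assume q: "q \<in> S \<and> x - q \<in> S\<^sup>\<bottom>"
  have "q - p \<in> S" using q assms by (simp add: subspace_diff)
  moreover have "(x - p) - (x - q) \<in> S\<^sup>\<bottom>"
    using q assms by (blast intro: subspace_diff subspace_orthogonal_comp)
  ultimately have "inner (q - p) (q - p) = 0"
    by (auto simp: orthogonal_comp_def orthogonal_def)
  then show "q = p" by simp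
qed (use assms in auto)

definition hermitian :: "'a::cayley_dickson cd \<Rightarrow> 'a cd \<Rightarrow> 'a cd"
  where "hermitian a b = orth_proj cd_C (a * cdcnj b)"

definition C_orthogonal :: "'a::cayley_dickson cd \<Rightarrow> 'a cd \<Rightarrow> bool"
  where "C_orthogonal a b \<longleftrightarrow> hermitian a b = 0"

text \<open>The element written \<open>{a, b}\<close>, for \<open>a\<close> and \<open>b\<close> orthogonal to \<open>cd_C\<close>.\<close>

definition brace :: "'a::cayley_dickson cd \<Rightarrow> 'a cd \<Rightarrow> 'a cd cd"
  where "brace a b = (1 / sqrt 2) *\<^sub>R CD (a + b) (cd_i * (- a + b))"

definition D_locus :: "'a::cayley_dickson cd cd set"
  where "D_locus = {brace a b | a b.
    a \<in> cd_C\<^sup>\<bottom> \<and> b \<in> cd_C\<^sup>\<bottom> \<and> C_orthogonal a b \<and> a \<in> (Ann b)\<^sup>\<bottom> \<and> b \<in> (Ann a)\<^sup>\<bottom>}"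

section \<open>Bundles\<close>

text \<open>
  A vector bundle over a subset \<open>B\<close> of a Euclidean space is represented by its fibers, given as
  subspaces of a fixed Euclidean space; its total space is then a subset of a product of
  Euclidean spaces, with the induced smooth structure and fiberwise metric.
\<close>

definition whitney_sum ::
    "('p \<Rightarrow> 'a set) \<Rightarrow> ('p \<Rightarrow> 'b set) \<Rightarrow> 'p \<Rightarrow> ('a \<times> 'b) set"
  where "whitney_sum E F p = E p \<times> F p"

definition trivial_bundle :: "'p \<Rightarrow> 'a::euclidean_space set"
  where "trivial_bundle p = UNIV"

definition sphere_bundle ::
    "'p set \<Rightarrow> ('p \<Rightarrow> 'a::euclidean_space set) \<Rightarrow> ('p \<times> 'a) set"
  where "sphere_bundle B E = {(p, v). p \<in> B \<and> v \<in> E p \<and> norm v = 1}"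

definition V2_R7 :: "(A3 \<times> A3) set"
  where "V2_R7 = {(a1, a2). cdRe a1 = 0 \<and> cdRe a2 = 0 \<and> norm a1 = 1 \<and> norm a2 = 1 \<and> orthogonal a1 a2}"

text \<open>
  A frame \<open>(a1, a2)\<close> has length \<open>sqrt 2\<close> as an element of \<open>A\<^sub>4\<close>; rescaling it to unit length does
  not change its annihilator.
\<close>

definition xi :: "A3 \<times> A3 \<Rightarrow> A4 set"
  where "xi p = Ann (CD (fst p) (snd p))"

section \<open>Diffeomorphisms between subsets of Euclidean spaces\<close>

text \<open>
  For open \<open>S\<close>, \<open>Ck_on k f S\<close> means that \<open>f\<close> is \<open>k\<close> times continuously differentiable on \<open>S\<close>.
  The derivative is taken in a fixed direction \<open>v\<close> at each step, so that the type of the function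
  does not change.
\<close>

primrec Ck_on ::
    "nat \<Rightarrow> ('a::euclidean_space \<Rightarrow> 'b::euclidean_space) \<Rightarrow> 'a set \<Rightarrow> bool"
  where
    "Ck_on 0 f S \<longleftrightarrow> continuous_on S f"
  | "Ck_on (Suc k) f S \<longleftrightarrow> (\<forall>x\<in>S. f differentiable (at x)) \<and>
       (\<forall>v. Ck_on k (\<lambda>x. frechet_derivative f (at x) v) S)"

text \<open>
  A map on an arbitrary subset of a Euclidean space is smooth if it extends, locally around every
  point of the subset, to a smooth map on an open set. On embedded submanifolds this is the usual
  notion of smooth map.
\<close>

definition smooth_map_on ::
    "'a::euclidean_space set \<Rightarrow> ('a \<Rightarrow> 'b::euclidean_space) \<Rightarrow> bool"
  where "smooth_map_on X f \<longleftrightarrow>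
    (\<forall>x\<in>X. \<exists>U g. open U \<and> x \<in> U \<and> (\<forall>k. Ck_on k g U) \<and> (\<forall>y\<in>X \<inter> U. g y = f y))"

definition diffeomorphic ::
    "'a::euclidean_space set \<Rightarrow> 'b::euclidean_space set \<Rightarrow> bool"
  where "diffeomorphic X Y \<longleftrightarrow>
    (\<exists>f g. smooth_map_on X f \<and> smooth_map_on Y g \<and> f ` X = Y \<and> g ` Y = X \<and>
      (\<forall>x\<in>X. g (f x) = x) \<and> (\<forall>y\<in>Y. f (g y) = y))"

end

theory Submission
  imports Defs
begin

text \<open>
  A unit zero-divisor of \<open>A\<^sub>4\<close> is \<open>(x, y) / \<surd>2\<close> for an orthonormal imaginary frame \<open>x, y\<close> of the
  octonions, and its annihilator consists of the \<open>(u, - (x y) u)\<close> with \<open>u\<close> orthogonal to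
  \<open>1, x, y, x y\<close>. For two such elements, with frames \<open>x, y\<close> and \<open>z, w\<close>, the three conditions
  defining the D-locus amount to the single equation \<open>x z + y w = 0\<close>. For a fixed \<open>(x, y)\<close> its
  solutions are \<open>z = \<surd>2 u + s x + t y\<close>, \<open>w = t x - s y - \<surd>2 v\<close> with \<open>(u, v)\<close> in the
  annihilator of \<open>(x, y)\<close> and \<open>|u|\<^sup>2 + |v|\<^sup>2 + s\<^sup>2 + t\<^sup>2 = 1\<close>, that is, the unit sphere in
  the fiber of \<open>\<xi> \<oplus> 2\<close>. This correspondence and its inverse are given by polynomials.
\<close>

section \<open>Octonion identities\<close>

lemma cd_inner_one: "inner (x :: 'a::cayley_dickson) 1 = inner (cdcnj x) 1"
  using cd_inner_cdcnj[of x 1] by (simp add: cdcnj_one)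

lemma cd_diff_mult: "(x - y) * z = x * z - y * (z :: 'a::cayley_dickson)"
  using cd_add_mult[of x "- y" z] by (simp add: cd_minus_mult)

lemma cd_mult_diff: "x * (y - z) = x * y - x * (z :: 'a::cayley_dickson)"
  using cd_mult_add[of x y "- z"] by (simp add: cd_mult_minus)

lemmas cd_mult_simps = cd_add_mult cd_mult_add cd_diff_mult cd_mult_diff cd_scaleR_mult
  cd_mult_scaleR cd_minus_mult cd_mult_minus cd_one_mult cd_mult_one

lemma cd_one_neq_0: "(1 :: 'a::cayley_dickson) \<noteq> 0"
proof
  assume "(1 :: 'a) = 0"
  then have "x = 0" for x :: 'a using cd_one_mult[of x] by simp
  then show False by (metis nonempty_Basis nonzero_Basis ex_in_conv)
qed

lemma inner_one_one: "inner (1 :: 'a::cayley_dickson) 1 = 1"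
proof -
  have "(2 * inner (1 :: 'a) 1) *\<^sub>R (1::'a) = 2 *\<^sub>R 1"
    using cd_mult_cdcnj[of "1::'a" 1] by (simp add: cdcnj_one cd_one_mult scaleR_2)
  then show ?thesis using cd_one_neq_0[where 'a = 'a] by (simp only: scaleR_cancel_right) simp
qed

lemma cdcnj_add_self: "x + cdcnj x = (2 * inner x 1) *\<^sub>R (1 :: 'a::cayley_dickson)"
  using cd_mult_cdcnj[of x 1] by (simp add: cdcnj_one cd_mult_one)

lemma cdRe_eq_0_iff: "cdRe (x :: 'a::cayley_dickson) = 0 \<longleftrightarrow> inner x 1 = 0"
  by (simp add: cdRe_def cdcnj_add_self cd_one_neq_0)

lemma cdcnj_imaginary: "inner (x :: 'a::cayley_dickson) 1 = 0 \<Longrightarrow> cdcnj x = - x"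
  using cdcnj_add_self[of x] by (simp add: add_eq_0_iff)

text \<open>Conjugation negates imaginary elements, so \<open>cd_mult_cdcnj\<close> turns into the
  Clifford relation. In particular, orthogonal imaginary elements anticommute.\<close>

lemma imaginary_anticommute:
  fixes a b :: "'a::cayley_dickson"
  assumes "inner a 1 = 0" "inner b 1 = 0"
  shows "a * b = - (b * a) - (2 * inner a b) *\<^sub>R 1"
proof -
  have "- (a * b) - b * a = (2 * inner a b) *\<^sub>R 1"
    using cd_mult_cdcnj[of a b] assms
    by (simp add: cdcnj_imaginary cdcnj_mult cd_mult_minus cd_minus_mult cdcnj_minus)
  then have "- (a * b) = b * a + (2 * inner a b) *\<^sub>R 1" by (simp only: diff_eq_eq add.commute)
  then have "- (- (a * b)) = - (b * a + (2 * inner a b) *\<^sub>R 1)" by (rule arg_cong)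
  then show ?thesis by simp
qed

section \<open>Adjoints, composition law and alternativity of the octonions\<close>

lemma inner_mult_left:
  fixes a b c :: A3
  shows "inner (a * b) c = inner b (cdcnj a * c)"
  by (simp add: inner_cd_def times_cd_def cdcnj_cd_def cdcnj_real_def algebra_simps)

text \<open>Conjugation is an isometry that reverses products, so it carries the adjoint of left
  multiplication to that of right multiplication.\<close>

lemma inner_mult_right:
  fixes a b c :: A3
  shows "inner (a * b) c = inner a (c * cdcnj b)"
proof -
  have "inner (a * b) c = inner (cdcnj b * cdcnj a) (cdcnj c)"
    by (metis cd_inner_cdcnj cdcnj_mult)
  also have "\<dots> = inner (cdcnj a) (b * cdcnj c)"
    by (simp add: inner_mult_left cdcnj_cdcnj)
  also have "\<dots> = inner a (c * cdcnj b)"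
    by (metis cd_inner_cdcnj cdcnj_cdcnj cdcnj_mult)
  finally show ?thesis .
qed

text \<open>Checked in the eight real coordinates. This is where the octonions are special: in
  \<open>A4\<close> the identity would make left multiplication by any nonzero element injective and
  exclude zero-divisors.\<close>

lemma octonion_cdcnj_mult_cancel:
  fixes a b :: A3
  shows "cdcnj a * (a * b) = inner a a *\<^sub>R b"
  by (simp add: cd_eq_iff inner_cd_def times_cd_def cdcnj_cd_def cdcnj_real_def algebra_simps)

lemma octonion_inner_mult_left_cancel:
  fixes a b c :: A3
  shows "inner (a * b) (a * c) = inner a a * inner b c"
  by (simp add: inner_mult_left octonion_cdcnj_mult_cancel)

lemma octonion_inner_mult_right_cancel:
  fixes a b c :: A3
  shows "inner (b * a) (c * a) = inner a a * inner b c"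
proof -
  have "inner (b * a) (c * a) = inner (cdcnj a * cdcnj b) (cdcnj a * cdcnj c)"
    by (metis cd_inner_cdcnj cdcnj_mult)
  then show ?thesis
    by (simp add: octonion_inner_mult_left_cancel cd_inner_cdcnj)
qed

lemma imaginary_mult_mult:
  fixes a b :: A3
  assumes "inner a 1 = 0"
  shows "a * (a * b) = - (inner a a *\<^sub>R b)"
  using octonion_cdcnj_mult_cancel[of a b] cdcnj_imaginary[OF assms]
  by (simp add: cd_minus_mult) (metis minus_minus)

lemma imaginary_mult_mult_right:
  fixes a b :: A3
  assumes "inner a 1 = 0"
  shows "(b * a) * a = - (inner a a *\<^sub>R b)"
proof -
  have "cdcnj ((b * a) * a) = cdcnj (- (inner a a *\<^sub>R b))"
    using imaginary_mult_mult[OF assms, of "cdcnj b"] cdcnj_imaginary[OF assms]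
    by (simp add: cdcnj_mult cdcnj_minus cdcnj_scaleR cd_mult_simps)
  then show ?thesis by (metis cdcnj_cdcnj)
qed

text \<open>Polarization of \<open>imaginary_mult_mult\<close>, applied to \<open>a + b\<close>. For
  orthogonal \<open>a\<close> and \<open>b\<close> it replaces the missing associativity.\<close>

lemma imaginary_mult_swap:
  fixes a b c :: A3
  assumes "inner a 1 = 0" "inner b 1 = 0"
  shows "a * (b * c) = - (b * (a * c)) - (2 * inner a b) *\<^sub>R c"
proof -
  have "(a + b) * ((a + b) * c) = - (inner (a + b) (a + b) *\<^sub>R c)"
    by (rule imaginary_mult_mult) (simp add: assms inner_add_left)
  then have "a * (a * c) + a * (b * c) + (b * (a * c) + b * (b * c)) =
      - ((inner a a + 2 * inner a b + inner b b) *\<^sub>R c)"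
    by (simp add: cd_add_mult cd_mult_add inner_add_left inner_add_right inner_commute add_ac)
  then show ?thesis
    unfolding imaginary_mult_mult[OF assms(1)] imaginary_mult_mult[OF assms(2)]
    by (simp add: scaleR_add_left algebra_simps eq_neg_iff_add_eq_0)
qed

lemma imaginary_inner_mult_left:
  fixes a b c :: A3
  assumes "inner a 1 = 0"
  shows "inner (a * b) c = - inner b (a * c)"
  by (simp add: inner_mult_left cdcnj_imaginary[OF assms] cd_minus_mult)

lemma imaginary_inner_mult_right:
  fixes a b c :: A3
  assumes "inner b 1 = 0"
  shows "inner (a * b) c = - inner a (c * b)"
  by (simp add: inner_mult_right cdcnj_imaginary[OF assms] cd_mult_minus)

section \<open>Zero-divisors of the sedenions\<close>

lemma Ann_CD_iff:
  "CD p q \<in> Ann (CD x y) \<longleftrightarrow> x * p = cdcnj q * y \<and> q * x = - (y * cdcnj p)"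
  for x y p q :: "'a::cayley_dickson"
  by (simp add: Ann_def times_CD zero_cd_def add_eq_0_iff2)

text \<open>The two annihilator equations express \<open>q\<close> in two ways through the conjugate
  \<open>w\<close> of \<open>p\<close>, and comparing them forces the orthogonalities. That
  \<open>x\<close> and \<open>y\<close> are orthogonal is left open here: for nonzero
  \<open>p\<close> it follows from the fact \<open>inner p p * inner x y = 0\<close>.\<close>

lemma Ann_sedenion_facts:
  fixes x y p q :: A3
  assumes x: "inner x 1 = 0" and y: "inner y 1 = 0"
    and N: "inner x x = N" "inner y y = N" "N \<noteq> 0"
    and pq: "CD p q \<in> Ann (CD x y)"
  shows "inner p 1 = 0" "inner q 1 = 0" "inner p x = 0" "inner p y = 0"
    "inner q x = 0" "inner q y = 0" "inner p (y * x) = 0"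
    "inner p p * inner x y = 0" "x * p = y * q"
proof -
  define w where "w = cdcnj p"
  have xp: "x * p = cdcnj q * y" and qx: "q * x = - (y * w)"
    using pq by (auto simp: Ann_CD_iff w_def)
  have "(q * x) * x = - (N *\<^sub>R q)" using imaginary_mult_mult_right[OF x] N by simp
  then have q1: "N *\<^sub>R q = (y * w) * x" by (simp add: qx cd_minus_mult)
  have "(x * p) * y = - (N *\<^sub>R cdcnj q)"
    unfolding xp using imaginary_mult_mult_right[OF y] N by simp
  then have "cdcnj ((x * p) * y) = cdcnj (- (N *\<^sub>R cdcnj q))" by (rule arg_cong)
  then have q2: "N *\<^sub>R q = - (y * (w * x))"
    using cdcnj_imaginary[OF x] cdcnj_imaginary[OF y]
    by (simp add: cdcnj_mult cdcnj_minus cdcnj_scaleR cdcnj_cdcnj cd_mult_simps w_def)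
  \<comment> \<open>The formulas \<open>e1\<close> and \<open>e2\<close> come from \<open>q1\<close>
    and \<open>q2\<close> by moving factors across the inner product. Tested with \<open>c\<close>
    equal to \<open>1\<close>, \<open>x\<close>, \<open>y\<close> and \<open>w\<close>, they give
    values of opposite sign, which therefore vanish.\<close>
  have e1: "N * inner q c = - inner (y * w) (c * x)" for c
  proof -
    have "N * inner q c = inner (N *\<^sub>R q) c" by simp
    then show ?thesis unfolding q1 imaginary_inner_mult_right[OF x] .
  qed
  have e2: "N * inner q c = inner (w * x) (y * c)" for c
  proof -
    have "N * inner q c = inner (N *\<^sub>R q) c" by simp
    then show ?thesis unfolding q2 using imaginary_inner_mult_left[OF y] by simp
  qed
  have yw1: "inner (y * w) c = - inner w (y * c)" for c
    by (rule imaginary_inner_mult_left[OF y])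
  have wx1: "inner (w * x) c = - inner w (c * x)" for c
    by (rule imaginary_inner_mult_right[OF x])
  have w_yx: "inner w (y * x) = 0" and q_1: "inner q 1 = 0"
    using e1[of 1] e2[of 1] N(3) by (simp_all add: yw1 wx1 cd_one_mult cd_mult_one)
  have xx: "inner (y * w) (x * x) = N * inner w y"
    using imaginary_mult_mult[OF x, of 1] N by (simp add: yw1 cd_mult_simps)
  have "inner (w * x) (y * x) = N * inner w y"
    by (simp add: octonion_inner_mult_right_cancel N)
  then have w_y: "inner w y = 0" and q_x: "inner q x = 0"
    using e1[of x] e2[of x] N(3) xx by simp_all
  have "inner (y * w) (y * x) = N * inner w x"
    by (simp add: octonion_inner_mult_left_cancel N)
  moreover have "inner (w * x) (y * y) = N * inner w x"
    using imaginary_mult_mult[OF y, of 1] N by (simp add: wx1 cd_mult_simps)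
  ultimately have w_x: "inner w x = 0" and q_y: "inner q y = 0"
    using e1[of y] e2[of y] N(3) by simp_all
  have yw_wx: "inner (y * w) (w * x) = 0"
    using e1[of w] e2[of w] by (simp add: inner_commute)
  have cq: "cdcnj q = - q" using q_1 by (rule cdcnj_imaginary)
  have qy: "q * y = - (y * q)"
    using imaginary_anticommute[OF q_1 y] q_y by simp
  show xpyq: "x * p = y * q" by (simp add: xp cq cd_minus_mult qy)
  \<comment> \<open>The real parts of \<open>p\<close> and of its conjugate agree, but the two
    equations give them opposite signs in terms of \<open>inner q (y * x)\<close>.\<close>
  have "N * inner p 1 = - inner (x * (x * p)) 1"
    using imaginary_mult_mult[OF x] N by simp
  also have "\<dots> = inner (y * q) x"
    unfolding xpyq imaginary_inner_mult_left[OF x] by (simp add: cd_mult_one)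
  also have "\<dots> = - inner q (y * x)" by (rule imaginary_inner_mult_left[OF y])
  finally have p_1: "N * inner p 1 = - inner q (y * x)" .
  have "N * inner w 1 = - inner (y * (y * w)) 1"
    using imaginary_mult_mult[OF y] N by simp
  also have "\<dots> = - inner (q * x) y"
    using imaginary_inner_mult_left[OF y, of "y * w" 1] by (simp add: cd_mult_one qx)
  also have "\<dots> = inner q (y * x)"
    by (simp add: imaginary_inner_mult_right[OF x])
  finally have "N * inner w 1 = inner q (y * x)" .
  moreover have "inner w 1 = inner p 1" unfolding w_def by (rule cd_inner_one[symmetric])
  ultimately show p1: "inner p 1 = 0" using p_1 N(3) by simp
  then have w: "w = - p" unfolding w_def by (rule cdcnj_imaginary)
  show "inner q 1 = 0" "inner p x = 0" "inner p y = 0" "inner q x = 0" "inner q y = 0"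
    "inner p (y * x) = 0"
    using q_1 w_x w_y q_x q_y w_yx by (simp_all add: w)
  then have "p * x = - (x * p)" using imaginary_anticommute[OF p1 x] by simp
  \<comment> \<open>With \<open>w = - p\<close>, the test at \<open>c = w\<close> becomes a product
    with common right factor \<open>p\<close>, and the composition law cancels that factor.\<close>
  then have "inner (y * p) (x * p) = 0" using yw_wx by (simp add: w cd_mult_simps)
  then show "inner p p * inner x y = 0"
    by (simp add: octonion_inner_mult_right_cancel inner_commute)
qed

text \<open>A nonzero zero-divisor has two components of the same norm because the octonion norm is
  multiplicative: \<open>|x||p| = |q||y|\<close> and \<open>|q||x| = |y||p|\<close>.\<close>

lemma zero_divisor_sedenion_imp:
  fixes x y :: A3
  assumes x: "inner x 1 = 0" and y: "inner y 1 = 0" and zd: "zero_divisor (CD x y)"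
  shows "inner x x = inner y y" "inner x y = 0"
proof -
  obtain e where e: "e \<noteq> 0" "CD x y * e = 0" and xy: "CD x y \<noteq> 0"
    using zd unfolding zero_divisor_def by auto
  obtain p q where "e = CD p q" by (cases e)
  with e have pq: "CD p q \<in> Ann (CD x y)" "CD p q \<noteq> 0" by (auto simp: Ann_def)
  have xp: "x * p = cdcnj q * y" and qx: "q * x = - (y * cdcnj p)"
    using pq(1) by (auto simp: Ann_CD_iff)
  have "inner (x * p) (x * p) = inner (cdcnj q * y) (cdcnj q * y)" by (simp add: xp)
  then have 1: "inner x x * inner p p = inner q q * inner y y"
    by (simp add: octonion_inner_mult_left_cancel cd_inner_cdcnj)
  have "inner (q * x) (q * x) = inner (y * cdcnj p) (y * cdcnj p)" by (simp add: qx)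
  then have 2: "inner q q * inner x x = inner y y * inner p p"
    by (simp add: octonion_inner_mult_left_cancel cd_inner_cdcnj)
  have nz: "inner p p + inner q q > 0" "inner x x + inner y y > 0"
    using pq(2) xy inner_ge_zero[of p] inner_ge_zero[of q] inner_ge_zero[of x] inner_ge_zero[of y]
      inner_eq_zero_iff[of p] inner_eq_zero_iff[of q] inner_eq_zero_iff[of x] inner_eq_zero_iff[of y]
    unfolding zero_cd_def cd.inject by linarith+
  \<comment> \<open>Sum of the two norm equations; the second factor is positive.\<close>
  have "(inner x x - inner y y) * (inner p p + inner q q) = 0"
    using 1 2 by (simp add: algebra_simps)
  then show eq: "inner x x = inner y y" using nz by simp
  then have N: "inner x x \<noteq> 0" using nz by linarith
  then have "inner p p = inner q q" using 1 eq by simp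
  then have "inner p p \<noteq> 0" using nz by linarith
  then show "inner x y = 0"
    using Ann_sedenion_facts(8)[OF x y refl eq[symmetric] N pq(1)] by simp
qed

section \<open>Quaternion triples and an explicit part of the annihilator\<close>

definition oct_frame :: "A3 \<Rightarrow> A3 \<Rightarrow> bool"
  where "oct_frame x y \<longleftrightarrow> inner x 1 = 0 \<and> inner y 1 = 0 \<and> inner x x = 1 \<and> inner y y = 1 \<and>
    inner x y = 0"

lemma V2_R7_iff: "(x, y) \<in> V2_R7 \<longleftrightarrow> oct_frame x y"
  by (auto simp: V2_R7_def oct_frame_def cdRe_eq_0_iff norm_eq_1 orthogonal_def)

text \<open>The elements \<open>x\<close>, \<open>y\<close>, \<open>k\<close> multiply like the
  quaternion units, and left multiplication by \<open>k\<close>, \<open>x\<close> or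
  \<open>y\<close> squares to minus the identity on all octonions.\<close>

lemma oct_frame_cross:
  assumes "oct_frame x y"
  defines "k \<equiv> x * y"
  shows "inner k 1 = 0" "inner k x = 0" "inner k y = 0" "inner k k = 1"
    "k * x = y" "k * y = - x" "k * (k * p) = - p" "y * x = - k"
    "x * x = - 1" "y * y = - 1" "x * (x * p) = - p" "y * (y * p) = - p"
proof -
  have x: "inner x 1 = 0" and y: "inner y 1 = 0" and n: "inner x x = 1" "inner y y = 1" "inner x y = 0"
    using assms by (auto simp: oct_frame_def)
  show k: "inner k 1 = 0"
    using imaginary_inner_mult_left[OF x, of y 1] n by (simp add: k_def cd_mult_one inner_commute)
  show kx: "inner k x = 0"
    using octonion_inner_mult_left_cancel[of x y 1] y by (simp add: k_def cd_mult_one)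
  show ky: "inner k y = 0"
    using octonion_inner_mult_right_cancel[of x y 1] x by (simp add: k_def cd_one_mult)
  show kk: "inner k k = 1"
    using octonion_inner_mult_left_cancel[of x y y] n by (simp add: k_def)
  show xx: "x * (x * p) = - p" and yy: "y * (y * p) = - p" and "k * (k * p) = - p" for p
    using imaginary_mult_mult[OF x] imaginary_mult_mult[OF y] imaginary_mult_mult[OF k] n kk by auto
  show "x * x = - 1" "y * y = - 1" using xx[of 1] yy[of 1] by (simp_all add: cd_mult_one)
  show yx: "y * x = - k"
    using imaginary_anticommute[OF y x] n by (simp add: k_def inner_commute)
  have "k * x = - (x * k)" using imaginary_anticommute[OF k x] kx by simp
  then show "k * x = y" using xx[of y] by (simp add: k_def)
  have "k * y = - (y * k)" using imaginary_anticommute[OF k y] ky by simp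
  moreover have "y * k = x" using yy[of x] yx by (simp add: cd_mult_minus)
  ultimately show "k * y = - x" by simp
qed

text \<open>Anticommuting \<open>p\<close> past \<open>x\<close>, \<open>y\<close> and
  \<open>x * y\<close> rewrites the second component \<open>q\<close> both as
  \<open>x * (y * p)\<close> and as \<open>- (y * (x * p))\<close>. Multiplying by \<open>x\<close>
  or \<open>y\<close> then cancels a square, which gives the two annihilator equations.\<close>

lemma mem_Ann_oct_frame:
  assumes f: "oct_frame x y"
    and p: "inner p 1 = 0" "inner p x = 0" "inner p y = 0" "inner p (x * y) = 0"
  shows "CD p (- ((x * y) * p)) \<in> Ann (CD x y)"
proof -
  note c = oct_frame_cross[OF f]
  have x: "inner x 1 = 0" and y: "inner y 1 = 0" and n: "inner x y = 0"
    using f by (auto simp: oct_frame_def)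
  define q where "q = - ((x * y) * p)"
  have "(x * y) * p = - (p * (x * y))"
    using imaginary_anticommute[OF c(1) p(1)] p by (simp add: inner_commute)
  also have "p * (x * y) = - (x * (p * y))"
    using imaginary_mult_swap[OF p(1) x] p by simp
  also have "p * y = - (y * p)"
    using imaginary_anticommute[OF p(1) y] p by simp
  finally have q: "q = x * (y * p)" by (simp add: q_def cd_mult_minus)
  also have "\<dots> = - (y * (x * p))"
    using imaginary_mult_swap[OF x y] n by simp
  finally have q': "q = - (y * (x * p))" .
  have q1: "inner q 1 = 0"
    using imaginary_inner_mult_left[OF c(1), of p 1] p by (simp add: q_def cd_mult_one)
  have qy: "inner q y = 0"
    using octonion_inner_mult_left_cancel[of y "x * p" 1] imaginary_inner_mult_left[OF x, of p 1] p
    by (simp add: q' cd_mult_one)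
  have qx: "inner q x = 0"
    using octonion_inner_mult_left_cancel[of x "y * p" 1] imaginary_inner_mult_left[OF y, of p 1] p
    by (simp add: q cd_mult_one)
  have "cdcnj q * y = y * q"
    using imaginary_anticommute[OF q1 y] qy by (simp add: cdcnj_imaginary[OF q1] cd_minus_mult)
  also have "\<dots> = x * p" by (simp add: q' cd_mult_minus c)
  finally have 1: "x * p = cdcnj q * y" by simp
  have "q * x = - (x * q)" using imaginary_anticommute[OF q1 x] qx by simp
  also have "\<dots> = y * p" by (simp add: q c)
  finally have "q * x = - (y * cdcnj p)" by (simp add: cdcnj_imaginary[OF p(1)] cd_mult_minus)
  with 1 show ?thesis by (simp add: Ann_CD_iff q_def)
qed

lemma inner_CD: "inner (CD a b) (CD c d) = inner a c + inner b d"
  by (simp add: inner_cd_def)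

lemma scaleR_CD: "r *\<^sub>R CD a b = CD (r *\<^sub>R a) (r *\<^sub>R b)"
  by (simp add: scaleR_cd_def)

lemma DIM_cd: "DIM('a::euclidean_space cd) = 2 * DIM('a)"
proof -
  have "card ((\<lambda>u::'a. CD u 0) ` Basis \<union> (\<lambda>v::'a. CD 0 v) ` Basis) =
      card ((\<lambda>u::'a. CD u 0) ` Basis) + card ((\<lambda>v::'a. CD 0 v) ` Basis)"
    by (rule card_Un_disjoint) auto
  also have "\<dots> = 2 * DIM('a)"
    by (simp add: card_image inj_on_def)
  finally show ?thesis by (simp add: Basis_cd_def)
qed

text \<open>Dimension count: \<open>1\<close>, \<open>x\<close>, \<open>y\<close>,
  \<open>x * y\<close> span at most four of the eight dimensions, which leaves a nonzero
  \<open>p\<close> for \<open>mem_Ann_oct_frame\<close>.\<close>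

lemma zero_divisor_oct_frame:
  assumes f: "oct_frame x y"
  shows "zero_divisor (CD x y)"
proof -
  have "dim {1, x, y, x * y} \<le> card {1, x, y, x * y}" by (rule dim_le_card') simp
  also have "\<dots> \<le> 4" by (simp add: card_insert_if)
  also have "\<dots> < DIM(A3)" by (simp add: DIM_cd)
  finally have "dim {1, x, y, x * y} < DIM(A3)" .
  from orthogonal_to_subspace_exists[OF this]
  obtain p where p: "p \<noteq> 0" "\<And>e. e \<in> span {1, x, y, x * y} \<Longrightarrow> orthogonal p e"
    by blast
  then have "inner p e = 0" if "e \<in> {1, x, y, x * y}" for e
    using that by (simp add: span_base orthogonal_def)
  then have "CD p (- ((x * y) * p)) \<in> Ann (CD x y)"
    by (intro mem_Ann_oct_frame[OF f]) auto
  moreover have "CD p (- ((x * y) * p)) \<noteq> 0" "CD x y \<noteq> 0"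
    using p f by (auto simp: zero_cd_def oct_frame_def)
  ultimately show ?thesis unfolding zero_divisor_def Ann_def by blast
qed

section \<open>Pairs of frames\<close>

lemma oct_frame_inner:
  assumes "oct_frame x y"
  shows "inner x 1 = 0" "inner y 1 = 0" "inner x x = 1" "inner y y = 1" "inner x y = 0"
    "inner y x = 0"
  using assms by (auto simp: oct_frame_def inner_commute)

lemma Ann_oct_frame_facts:
  assumes f: "oct_frame x y" and pq: "CD p q \<in> Ann (CD x y)"
  shows "inner p 1 = 0" "inner q 1 = 0" "inner p x = 0" "inner p y = 0"
    "inner q x = 0" "inner q y = 0" "x * p = y * q" "inner p p = inner q q" "inner p q = 0"
proof -
  note n = oct_frame_inner[OF f]
  note a = Ann_sedenion_facts[OF n(1,2,3,4) _ pq]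
  show "inner p 1 = 0" "inner q 1 = 0" "inner p x = 0" "inner p y = 0"
    "inner q x = 0" "inner q y = 0" and e: "x * p = y * q"
    using a by simp_all
  have "inner (x * p) (x * p) = inner (y * q) (y * q)" by (simp add: e)
  then show "inner p p = inner q q" by (simp add: octonion_inner_mult_left_cancel n)
  have "inner p q = inner (x * p) (x * q)" by (simp add: octonion_inner_mult_left_cancel n)
  also have "\<dots> = 0" by (simp add: e octonion_inner_mult_right_cancel n)
  finally show "inner p q = 0" .
qed

text \<open>Conjugating the equation reverses its products. The resulting symmetry between the two
  frames transfers results on the annihilator of the first frame to that of the second.\<close>

lemma oct_frames_commute:
  assumes f: "oct_frame x y" and g: "oct_frame z w" and e: "x * z + y * w = 0"
  shows "z * x + w * y = 0"
proof -
  have "cdcnj (x * z + y * w) = 0" by (simp add: e)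
  then show ?thesis
    using cdcnj_imaginary[OF oct_frame_inner(1)[OF f]] cdcnj_imaginary[OF oct_frame_inner(2)[OF f]]
      cdcnj_imaginary[OF oct_frame_inner(1)[OF g]] cdcnj_imaginary[OF oct_frame_inner(2)[OF g]]
    by (simp add: cdcnj_add cdcnj_mult cd_mult_simps)
qed

text \<open>Left multiplication by a unit octonion is an isometry: \<open>inner z p\<close> equals
  the pairing of \<open>x * z = - (y * w)\<close> with \<open>x * p = y * q\<close>, which is
  \<open>- inner w q\<close>.\<close>

lemma oct_frames_orthogonal_Ann:
  assumes f: "oct_frame x y" and e: "x * z + y * w = 0" and pq: "CD p q \<in> Ann (CD x y)"
  shows "inner z p + inner w q = 0"
proof -
  note n = oct_frame_inner[OF f]
  have e': "x * z = - (y * w)" using e by (simp add: add_eq_0_iff2)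
  have "inner z p = inner (x * z) (x * p)" by (simp add: octonion_inner_mult_left_cancel n)
  also have "\<dots> = - inner w q"
    by (simp add: e' Ann_oct_frame_facts[OF f pq] octonion_inner_mult_left_cancel n)
  finally show ?thesis by simp
qed

lemma oct_frames_C_orthogonal:
  assumes f: "oct_frame x y" and g: "oct_frame z w" and e: "x * z + y * w = 0"
  shows "inner x z + inner y w = 0" "inner w x = inner y z"
proof -
  note n = oct_frame_inner[OF f] and m = oct_frame_inner[OF g] and c = oct_frame_cross[OF f]
  have "inner (x * z + y * w) 1 = 0" by (simp add: e)
  then show "inner x z + inner y w = 0"
    by (simp add: inner_add_left imaginary_inner_mult_left[OF n(1)] imaginary_inner_mult_left[OF n(2)]
      cd_mult_one inner_commute[of z] inner_commute[of w])
  have e': "x * z = - (y * w)" using e by (simp add: add_eq_0_iff2)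
  have "inner y z = inner (x * y) (x * z)" by (simp add: octonion_inner_mult_left_cancel n)
  also have "\<dots> = inner (y * x) (y * w)" by (simp add: e' c(8))
  also have "\<dots> = inner w x" by (simp add: octonion_inner_mult_left_cancel n inner_commute)
  finally show "inner w x = inner y z" by simp
qed

text \<open>In \<open>x * z + y * w\<close> the terms in \<open>s\<close> cancel because
  \<open>x\<close> and \<open>y\<close> have the same square, those in \<open>t\<close> because
  \<open>x\<close> and \<open>y\<close> anticommute, and those in \<open>r\<close> because
  \<open>x * u = y * v\<close>. Orthonormality uses that \<open>u\<close> and \<open>v\<close> are
  orthogonal, of equal length, and orthogonal to \<open>x\<close> and \<open>y\<close>.\<close>

lemma oct_frame_of_Ann:
  assumes f: "oct_frame x y" and uv: "CD u v \<in> Ann (CD x y)"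
    and len: "r\<^sup>2 * inner u u + s\<^sup>2 + t\<^sup>2 = 1"
  defines "z \<equiv> r *\<^sub>R u + s *\<^sub>R x + t *\<^sub>R y" and "w \<equiv> t *\<^sub>R x - s *\<^sub>R y - r *\<^sub>R v"
  shows "oct_frame z w" "x * z + y * w = 0" "inner z x = s" "inner z y = t"
proof -
  note n = oct_frame_inner[OF f] and c = oct_frame_cross[OF f] and a = Ann_oct_frame_facts[OF f uv]
  show "x * z + y * w = 0"
    by (simp add: z_def w_def cd_mult_simps c(8,9,10) a(7) algebra_simps)
  show "inner z x = s" "inner z y = t"
    using a n by (simp_all add: z_def inner_add_left)
  have u: "inner x u = 0" "inner y u = 0" "inner x v = 0" "inner y v = 0" "inner v u = 0"
    using a by (simp_all add: inner_commute)
  have "inner z z = 1" "inner w w = 1"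
    using len by (simp_all add: z_def w_def inner_add_left inner_add_right inner_diff_left
      inner_diff_right a n u power2_eq_square add_ac)
  then show "oct_frame z w"
    by (simp add: oct_frame_def) (simp add: z_def w_def inner_add_left inner_add_right
      inner_diff_left inner_diff_right a n u)
qed

text \<open>The residual \<open>p\<close> after subtracting the four projections is itself an
  admissible test vector, so it is orthogonal to \<open>s\<close>, hence to itself.\<close>

lemma orthogonal_residual_eq:
  fixes s x y k :: A3
  assumes orth: "\<And>p. inner p 1 = 0 \<Longrightarrow> inner p x = 0 \<Longrightarrow> inner p y = 0 \<Longrightarrow> inner p k = 0 \<Longrightarrow> inner s p = 0"
    and n: "inner x 1 = 0" "inner y 1 = 0" "inner k 1 = 0" "inner x x = 1" "inner y y = 1"
      "inner k k = 1" "inner x y = 0" "inner k x = 0" "inner k y = 0"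
  shows "s = inner s 1 *\<^sub>R 1 + inner s x *\<^sub>R x + inner s y *\<^sub>R y + inner s k *\<^sub>R k"
proof -
  define p where
    "p = s - (inner s 1 *\<^sub>R 1 + inner s x *\<^sub>R x + inner s y *\<^sub>R y + inner s k *\<^sub>R k)"
  have n': "inner 1 x = 0" "inner 1 y = 0" "inner 1 k = 0" "inner y x = 0" "inner x k = 0"
    "inner y k = 0"
    using n by (simp_all add: inner_commute)
  have p: "inner p 1 = 0" "inner p x = 0" "inner p y = 0" "inner p k = 0"
    by (simp_all add: p_def inner_diff_left inner_add_left inner_one_one n n')
  then have "inner s p = 0" by (rule orth)
  moreover have "inner p p = inner s p - inner (inner s 1 *\<^sub>R 1 + inner s x *\<^sub>R x +
      inner s y *\<^sub>R y + inner s k *\<^sub>R k) p"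
    unfolding p_def by (simp add: inner_diff_left)
  moreover have "inner 1 p = 0" "inner x p = 0" "inner y p = 0" "inner k p = 0"
    using p by (simp_all add: inner_commute)
  ultimately have "inner p p = 0"
    by (simp add: inner_add_left)
  then show ?thesis by (simp add: p_def)
qed

text \<open>With \<open>k = x y\<close>, orthogonality to the annihilator says that \<open>z + k w\<close> lies in the span of
  \<open>1, x, y, k\<close>. The norm and orthogonality conditions on \<open>(z, w)\<close> then kill the coefficients of
  \<open>1\<close> and \<open>k\<close>.\<close>

lemma Ann_of_oct_frame:
  assumes f: "oct_frame x y" and g: "oct_frame z w"
    and h: "inner x z + inner y w = 0" "inner w x = inner y z"
    and orth: "\<And>p q. CD p q \<in> Ann (CD x y) \<Longrightarrow> inner z p + inner w q = 0"
  defines "s \<equiv> inner z x" and "t \<equiv> inner z y"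
  shows "CD (z - s *\<^sub>R x - t *\<^sub>R y) (t *\<^sub>R x - s *\<^sub>R y - w) \<in> Ann (CD x y)"
proof -
  note n = oct_frame_inner[OF f] and m = oct_frame_inner[OF g]
  define k where "k = x * y"
  note c = oct_frame_cross[OF f, folded k_def]
  note kl = imaginary_inner_mult_left[OF c(1)]
  define a b where "a = inner z k" and "b = inner w k"
  \<comment> \<open>C-orthogonality determines the components of \<open>w\<close> along
    \<open>x\<close> and \<open>y\<close> from those of \<open>z\<close>.\<close>
  have wx: "inner w x = t" and wy: "inner w y = - s"
    using h by (simp_all add: s_def t_def inner_commute)
  have "z + k * w = inner (z + k * w) 1 *\<^sub>R 1 + inner (z + k * w) x *\<^sub>R x +
      inner (z + k * w) y *\<^sub>R y + inner (z + k * w) k *\<^sub>R k"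
  proof (rule orthogonal_residual_eq)
    fix p assume p: "inner p 1 = 0" "inner p x = 0" "inner p y = 0" "inner p k = 0"
    \<comment> \<open>Left multiplication by \<open>k\<close> is skew, so this pairing is
      \<open>inner (z + k * w) p\<close>.\<close>
    have "inner z p + inner w (- (k * p)) = 0"
      unfolding k_def using p by (intro orth mem_Ann_oct_frame[OF f]) (simp_all add: k_def)
    then show "inner (z + k * w) p = 0" by (simp add: inner_add_left kl)
  qed (use n c in auto)
  moreover have "inner (z + k * w) 1 = - b"
    by (simp add: inner_add_left m kl cd_mult_one b_def)
  moreover have "inner (z + k * w) x = 2 * s" "inner (z + k * w) y = 2 * t"
    by (simp_all add: inner_add_left kl c wx wy s_def t_def)
  moreover have "inner (z + k * w) k = a"
    using c(7)[of 1] by (simp add: inner_add_left kl m cd_mult_one a_def)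
  ultimately have S: "z + k * w = (- b) *\<^sub>R 1 + (2 * s) *\<^sub>R x + (2 * t) *\<^sub>R y + a *\<^sub>R k" by simp
  have "inner (z + k * w) z = 2 * s * s + 2 * t * t + a * a"
    unfolding S by (simp add: inner_add_right inner_diff_right inner_commute[of _ z] m a_def s_def t_def)
  then have 1: "inner (k * w) z = 2 * s * s + 2 * t * t + a * a - 1"
    by (simp add: inner_add_left m)
  have kw: "inner (k * w) w = 0"
    using octonion_inner_mult_right_cancel[of k w 1] c m by (simp add: cd_one_mult)
  have "inner (z + k * w) w = a * b"
    unfolding S by (simp add: inner_add_right inner_diff_right inner_commute[of _ w] wx wy m a_def b_def)
  then have ab: "a * b = 0" by (simp add: inner_add_left m kw)
  have "inner (k * w) (k * w) = 1" by (simp add: octonion_inner_mult_left_cancel c m)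
  then have "inner (z + k * w) (z + k * w) = 2 + 2 * inner (k * w) z"
    by (simp add: inner_add_left inner_add_right m inner_commute)
  moreover have "inner (z + k * w) (z + k * w) = b * b + 4 * s * s + 4 * t * t + a * a"
  proof -
    have n': "inner 1 x = 0" "inner 1 y = 0" "inner 1 k = 0" "inner x k = 0" "inner y k = 0"
      using n c by (simp_all add: inner_commute)
    show ?thesis
      unfolding S by (simp add: inner_add_left inner_add_right inner_diff_left inner_diff_right
        inner_one_one n n' c algebra_simps)
  qed
  \<comment> \<open>The squared norm of \<open>z + k * w\<close> is computed once from the frame
    \<open>z\<close>, \<open>w\<close> and once from the expansion \<open>S\<close>. Together with
    \<open>a * b = 0\<close>, from pairing \<open>S\<close> with \<open>w\<close>, this kills both
    coefficients.\<close>
  ultimately have "a * a = b * b" using 1 by simp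
  with ab have a0: "a = 0" and b0: "b = 0" by auto
  \<comment> \<open>Since \<open>k * (k * w) = - w\<close>, multiplying by \<open>k\<close> solves
    for \<open>w\<close> and brings the pair into the form of
    \<open>mem_Ann_oct_frame\<close>.\<close>
  have "k * (z + k * w) = (2 * s) *\<^sub>R y - (2 * t) *\<^sub>R x"
    unfolding S by (simp add: a0 b0 cd_mult_simps c)
  then have w: "w = k * z - (2 * s) *\<^sub>R y + (2 * t) *\<^sub>R x"
    by (simp add: cd_mult_simps c algebra_simps)
  define p where "p = z - s *\<^sub>R x - t *\<^sub>R y"
  have "(2 * s) *\<^sub>R y = s *\<^sub>R y + s *\<^sub>R y" "(2 * t) *\<^sub>R x = t *\<^sub>R x + t *\<^sub>R x"
    by (simp_all flip: scaleR_left.add)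
  then have q: "t *\<^sub>R x - s *\<^sub>R y - w = - (k * p)"
    by (simp add: p_def cd_mult_simps c w algebra_simps)
  have xk: "inner x k = 0" "inner y k = 0"
    using c by (simp_all add: inner_commute)
  have "inner p 1 = 0" "inner p x = 0" "inner p y = 0" "inner p k = 0"
    using a0 by (simp_all add: p_def inner_diff_left n m c xk s_def t_def a_def)
  then have "CD p (- (k * p)) \<in> Ann (CD x y)"
    unfolding k_def by (intro mem_Ann_oct_frame[OF f])
  then show ?thesis unfolding q p_def .
qed

section \<open>The D-locus over pairs of unit zero-divisors\<close>

lemma mem_cd_C_perp_iff:
  "c \<in> cd_C\<^sup>\<bottom> \<longleftrightarrow> inner (cd1 c) 1 = 0 \<and> inner (cd2 c) 1 = 0"
  for c :: "'a::cayley_dickson cd"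
proof -
  have "c \<in> cd_C\<^sup>\<bottom> \<longleftrightarrow> orthogonal c 1 \<and> orthogonal c cd_i"
  proof
    assume "c \<in> cd_C\<^sup>\<bottom>"
    then show "orthogonal c 1 \<and> orthogonal c cd_i"
      by (auto simp: orthogonal_comp_def cd_C_def orthogonal_commute span_base)
  next
    assume "orthogonal c 1 \<and> orthogonal c cd_i"
    then have "orthogonal c e" if "e \<in> span {1, cd_i}" for e
      using that by (rule_tac orthogonal_to_span) auto
    then show "c \<in> cd_C\<^sup>\<bottom>"
      by (auto simp: orthogonal_comp_def cd_C_def orthogonal_commute)
  qed
  then show ?thesis
    by (simp add: orthogonal_def inner_cd_def one_cd_def cd_i_def)
qed

text \<open>The projection is exhibited explicitly as \<open>p\<close>, whose coefficients are the
  inner products of the two halves with \<open>1\<close>; it vanishes exactly when both do.\<close>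

lemma C_orthogonal_iff:
  "C_orthogonal a b \<longleftrightarrow> a * cdcnj b \<in> cd_C\<^sup>\<bottom>"
  for a b :: "'a::cayley_dickson cd"
proof -
  define c where "c = a * cdcnj b"
  define p where "p = inner (cd1 c) 1 *\<^sub>R 1 + inner (cd2 c) 1 *\<^sub>R (cd_i :: 'a cd)"
  have "p \<in> cd_C"
    unfolding p_def cd_C_def by (intro span_add span_scale span_base) auto
  moreover have "c - p \<in> cd_C\<^sup>\<bottom>"
    by (simp add: mem_cd_C_perp_iff p_def one_cd_def cd_i_def inner_diff_left inner_one_one)
  ultimately have "orth_proj cd_C c = p"
    by (intro orth_proj_eqI) (simp_all add: cd_C_def)
  then have "C_orthogonal a b \<longleftrightarrow> p = 0"
    by (simp add: C_orthogonal_def hermitian_def c_def)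
  also have "\<dots> \<longleftrightarrow> c \<in> cd_C\<^sup>\<bottom>"
    using cd_one_neq_0[where 'a='a]
    by (simp add: mem_cd_C_perp_iff p_def one_cd_def cd_i_def cd_eq_iff)
  finally show ?thesis by (simp add: c_def)
qed

lemma C_orthogonal_CD_iff:
  fixes x y z w :: A3
  assumes "inner x 1 = 0" "inner y 1 = 0" "inner z 1 = 0" "inner w 1 = 0"
  shows "C_orthogonal (CD x y) (CD z w) \<longleftrightarrow> inner x z + inner y w = 0 \<and> inner w x = inner y z"
proof -
  have "inner (x * z) 1 = - inner x z" "inner (w * y) 1 = - inner y w"
    "inner (w * x) 1 = - inner w x" "inner (y * z) 1 = - inner y z"
    using assms imaginary_inner_mult_right[of z x 1] imaginary_inner_mult_right[of y w 1]
      imaginary_inner_mult_right[of x w 1] imaginary_inner_mult_right[of z y 1]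
    by (simp_all add: cd_one_mult inner_commute)
  then show ?thesis
    using assms
    by (auto simp: C_orthogonal_iff mem_cd_C_perp_iff cdcnj_CD times_CD cdcnj_imaginary cd_mult_simps
      cdcnj_minus inner_diff_left inner_add_left)
qed

lemma Ann_scaleR: "r \<noteq> 0 \<Longrightarrow> Ann (r *\<^sub>R x) = Ann x"
  for x :: "'a::cayley_dickson"
  by (simp add: Ann_def cd_scaleR_mult)

lemma zero_divisor_scaleR: "r \<noteq> 0 \<Longrightarrow> zero_divisor (r *\<^sub>R x) \<longleftrightarrow> zero_divisor x"
  for x :: "'a::cayley_dickson"
  by (simp add: zero_divisor_def cd_scaleR_mult)

lemma C_orthogonal_scaleR:
  "r \<noteq> 0 \<Longrightarrow> s \<noteq> 0 \<Longrightarrow> C_orthogonal (r *\<^sub>R a) (s *\<^sub>R b) \<longleftrightarrow> C_orthogonal a b"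
  by (simp add: C_orthogonal_iff cdcnj_scaleR cd_scaleR_mult cd_mult_scaleR mem_cd_C_perp_iff)

lemma scaleR_mem_orthogonal_comp_iff: "r \<noteq> 0 \<Longrightarrow> r *\<^sub>R x \<in> S\<^sup>\<bottom> \<longleftrightarrow> x \<in> S\<^sup>\<bottom>"
  by (simp add: orthogonal_comp_def orthogonal_def)

lemma CD_mem_Ann_perp_iff:
  "CD z w \<in> (Ann (CD x y))\<^sup>\<bottom> \<longleftrightarrow>
    (\<forall>p q. CD p q \<in> Ann (CD x y) \<longrightarrow> inner z p + inner w q = 0)"
  unfolding orthogonal_comp_def orthogonal_def inner_cd_def
  by (auto simp: inner_commute) (metis cd.collapse inner_commute)

lemma D_condition_oct_frames_iff:
  assumes f: "oct_frame x y" and g: "oct_frame z w"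
  shows "C_orthogonal (CD x y) (CD z w) \<and> CD x y \<in> (Ann (CD z w))\<^sup>\<bottom> \<and> CD z w \<in> (Ann (CD x y))\<^sup>\<bottom> \<longleftrightarrow>
    x * z + y * w = 0" (is "?D \<longleftrightarrow> ?R")
proof
  assume ?D
  then have h: "inner x z + inner y w = 0" "inner w x = inner y z"
    and orth: "\<And>p q. CD p q \<in> Ann (CD x y) \<Longrightarrow> inner z p + inner w q = 0"
    using C_orthogonal_CD_iff oct_frame_inner[OF f] oct_frame_inner[OF g]
    by (simp_all add: CD_mem_Ann_perp_iff)
  note c = oct_frame_cross[OF f]
  \<comment> \<open>Membership in the annihilator gives \<open>x * p = y * q\<close>; once expanded,
    the terms along \<open>x\<close> and \<open>y\<close> cancel and the equation for
    \<open>z\<close> and \<open>w\<close> remains.\<close>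
  have "x * (z - inner z x *\<^sub>R x - inner z y *\<^sub>R y) = y * (inner z y *\<^sub>R x - inner z x *\<^sub>R y - w)"
    using Ann_oct_frame_facts(7)[OF f Ann_of_oct_frame[OF f g h orth]] by blast
  then show ?R
    by (simp add: cd_mult_simps c(8,9,10) algebra_simps)
next
  assume R: ?R
  show ?D
    using oct_frames_C_orthogonal[OF f g R] oct_frames_orthogonal_Ann[OF f R]
      oct_frames_orthogonal_Ann[OF g oct_frames_commute[OF f g R]]
      C_orthogonal_CD_iff oct_frame_inner[OF f] oct_frame_inner[OF g]
    by (simp add: CD_mem_Ann_perp_iff)
qed

section \<open>Recovering the two entries of a brace\<close>

lemma cd_i_mult_cd_i_mult: "cd_i * (cd_i * c) = - c"
  by (simp add: cd_i_def times_cd_def cd_eq_iff cdcnj_minus cdcnj_cdcnj cdcnj_one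
    cd_mult_simps)

text \<open>Applying \<open>cd_i\<close> a second time turns \<open>cd_i * (- a + b)\<close> into
  \<open>a - b\<close>, so sum and difference isolate \<open>a\<close> and \<open>b\<close>. The
  inverse of \<open>brace\<close> is thus linear.\<close>

lemma brace_decode:
  "cd1 (brace a b) + cd_i * cd2 (brace a b) = sqrt 2 *\<^sub>R a"
  "cd1 (brace a b) - cd_i * cd2 (brace a b) = sqrt 2 *\<^sub>R b"
proof -
  have "(1 / sqrt 2 + 1 / sqrt 2) = sqrt 2" by (simp add: field_simps)
  then have "(1 / sqrt 2) *\<^sub>R c + (1 / sqrt 2) *\<^sub>R c = sqrt 2 *\<^sub>R c" for c :: "'a cd"
    by (metis scaleR_left.add)
  then show "cd1 (brace a b) + cd_i * cd2 (brace a b) = sqrt 2 *\<^sub>R a"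
    "cd1 (brace a b) - cd_i * cd2 (brace a b) = sqrt 2 *\<^sub>R b"
    by (simp_all add: brace_def cd_mult_scaleR cd_i_mult_cd_i_mult algebra_simps)
qed

lemma brace_inject: "brace a b = brace c d \<longleftrightarrow> a = c \<and> b = d"
proof
  assume "brace a b = brace c d"
  then have "sqrt 2 *\<^sub>R a = sqrt 2 *\<^sub>R c" "sqrt 2 *\<^sub>R b = sqrt 2 *\<^sub>R d"
    by (metis brace_decode)+
  then show "a = c \<and> b = d" by simp
qed simp

lemma brace_mem_D_locus_iff:
  "brace a b \<in> D_locus \<longleftrightarrow> a \<in> cd_C\<^sup>\<bottom> \<and> b \<in> cd_C\<^sup>\<bottom> \<and> C_orthogonal a b \<and>
    a \<in> (Ann b)\<^sup>\<bottom> \<and> b \<in> (Ann a)\<^sup>\<bottom>"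
  by (auto simp: D_locus_def brace_inject)

definition unit_pair :: "A3 \<Rightarrow> A3 \<Rightarrow> A4"
  where "unit_pair x y = (1 / sqrt 2) *\<^sub>R CD x y"

text \<open>The two halves of a zero-divisor have equal norms, so in a unit one each has squared
  length 1/2; multiplying by \<open>sqrt 2\<close> gives the frame.\<close>

lemma unit_zero_divisor_iff:
  "c \<in> cd_C\<^sup>\<bottom> \<and> zero_divisor c \<and> norm c = 1 \<longleftrightarrow> (\<exists>x y. oct_frame x y \<and> c = unit_pair x y)"
proof
  assume c: "c \<in> cd_C\<^sup>\<bottom> \<and> zero_divisor c \<and> norm c = 1"
  obtain x y where xy: "c = CD x y" by (cases c)
  have i: "inner x 1 = 0" "inner y 1 = 0" using c by (simp_all add: mem_cd_C_perp_iff xy)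
  have "inner x x = inner y y" "inner x y = 0"
    using zero_divisor_sedenion_imp[OF i] c by (simp_all add: xy)
  moreover have "inner x x + inner y y = 1"
    using c by (simp add: norm_eq_1 inner_CD xy)
  ultimately have "oct_frame (sqrt 2 *\<^sub>R x) (sqrt 2 *\<^sub>R y)"
    using i by (simp add: oct_frame_def flip: mult.assoc)
  moreover have "c = unit_pair (sqrt 2 *\<^sub>R x) (sqrt 2 *\<^sub>R y)"
    by (simp add: unit_pair_def xy cd_eq_iff)
  ultimately show "\<exists>x y. oct_frame x y \<and> c = unit_pair x y" by blast
next
  assume "\<exists>x y. oct_frame x y \<and> c = unit_pair x y"
  then obtain x y where f: "oct_frame x y" and c: "c = unit_pair x y" by blast
  have "zero_divisor c"
    using zero_divisor_oct_frame[OF f] by (simp add: c unit_pair_def zero_divisor_scaleR)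
  moreover have "norm c = 1"
  proof -
    have "norm (CD x y) = sqrt 2"
      using oct_frame_inner[OF f] by (simp add: norm_eq_sqrt_inner inner_CD)
    then show ?thesis unfolding c unit_pair_def norm_scaleR by simp
  qed
  moreover have "c \<in> cd_C\<^sup>\<bottom>"
    using oct_frame_inner[OF f] by (simp add: c unit_pair_def mem_cd_C_perp_iff)
  ultimately show "c \<in> cd_C\<^sup>\<bottom> \<and> zero_divisor c \<and> norm c = 1"
    by blast
qed

lemma D_locus_unit_zero_divisors_eq:
  "{brace a b | a b. a \<in> cd_C\<^sup>\<bottom> \<and> b \<in> cd_C\<^sup>\<bottom> \<and> brace a b \<in> D_locus \<and>
      zero_divisor a \<and> norm a = 1 \<and> zero_divisor b \<and> norm b = 1} =
    {brace (unit_pair x y) (unit_pair z w) | x y z w.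
      oct_frame x y \<and> oct_frame z w \<and> x * z + y * w = 0}" (is "?L = ?R")
proof -
  have D: "brace (unit_pair x y) (unit_pair z w) \<in> D_locus \<longleftrightarrow> x * z + y * w = 0"
    if "oct_frame x y" "oct_frame z w" for x y z w
    using D_condition_oct_frames_iff[OF that] oct_frame_inner[OF that(1)] oct_frame_inner[OF that(2)]
    by (simp add: brace_mem_D_locus_iff unit_pair_def C_orthogonal_scaleR Ann_scaleR
      scaleR_mem_orthogonal_comp_iff mem_cd_C_perp_iff)
  have "?L = {brace a b | a b. (a \<in> cd_C\<^sup>\<bottom> \<and> zero_divisor a \<and> norm a = 1) \<and>
      (b \<in> cd_C\<^sup>\<bottom> \<and> zero_divisor b \<and> norm b = 1) \<and> brace a b \<in> D_locus}"
    by blast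
  also have "\<dots> = {brace (unit_pair x y) (unit_pair z w) | x y z w.
      oct_frame x y \<and> oct_frame z w \<and> brace (unit_pair x y) (unit_pair z w) \<in> D_locus}"
    unfolding unit_zero_divisor_iff by blast
  also have "\<dots> = ?R"
    using D by blast
  finally show ?thesis .
qed

section \<open>Smoothness of polynomial maps\<close>

text \<open>The product rule leaves undifferentiated factors in the derivative, so the classes must
  be known to be nested.\<close>

lemma Ck_on_SucD: "Ck_on (Suc k) f S \<Longrightarrow> Ck_on k f S"
proof (induction k arbitrary: f)
  case 0
  then show ?case
    by (auto simp: continuous_on_eq_continuous_within
      intro: continuous_at_imp_continuous_at_within[OF differentiable_imp_continuous_within])
next
  case (Suc k)
  have "Ck_on (Suc k) (\<lambda>x. frechet_derivative f (at x) v) S" for v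
    using Suc.prems Ck_on.simps(2)[of "Suc k" f S] by blast
  then have "Ck_on k (\<lambda>x. frechet_derivative f (at x) v) S" for v
    by (rule Suc.IH)
  then show ?case using Suc.prems Ck_on.simps(2)[of "Suc k" f S] Ck_on.simps(2)[of k f S] by blast
qed

text \<open>Smoothness on the whole ambient space suffices here, because both maps are restrictions
  of polynomial maps.\<close>

definition smooth :: "('a::euclidean_space \<Rightarrow> 'b::euclidean_space) \<Rightarrow> bool"
  where "smooth f \<longleftrightarrow> (\<forall>k. Ck_on k f UNIV)"

lemma Ck_on_const: "Ck_on k (\<lambda>x. c) UNIV"
  by (induction k arbitrary: c) auto

lemma Ck_on_ident: "Ck_on k (\<lambda>x. x) UNIV"
  by (cases k) (auto simp: Ck_on_const frechet_derivative_ident)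

lemma Ck_on_add:
  "Ck_on k f UNIV \<Longrightarrow> Ck_on k g UNIV \<Longrightarrow> Ck_on k (\<lambda>x. f x + g x) UNIV"
proof (induction k arbitrary: f g)
  case (Suc k)
  have d: "f differentiable at x" "g differentiable at x" for x
    using Suc.prems by simp_all
  have "frechet_derivative (\<lambda>x. f x + g x) (at x) =
      (\<lambda>v. frechet_derivative f (at x) v + frechet_derivative g (at x) v)" for x
    by (rule frechet_derivative_at[symmetric])
      (intro has_derivative_add d[unfolded frechet_derivative_works])
  with Suc d show ?case by simp
qed (simp add: continuous_on_add)

lemma Ck_on_bounded_linear:
  assumes L: "bounded_linear L"
  shows "Ck_on k f UNIV \<Longrightarrow> Ck_on k (\<lambda>x. L (f x)) UNIV"
proof (induction k arbitrary: f)
  case 0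
  then show ?case by (simp add: bounded_linear.continuous_on[OF L])
next
  case (Suc k)
  have d: "f differentiable at x" for x
    using Suc.prems by simp
  have D: "((\<lambda>x. L (f x)) has_derivative (\<lambda>v. L (frechet_derivative f (at x) v))) (at x)" for x
    by (intro bounded_linear.has_derivative[OF L] d[unfolded frechet_derivative_works])
  then have "frechet_derivative (\<lambda>x. L (f x)) (at x) = (\<lambda>v. L (frechet_derivative f (at x) v))" for x
    by (rule frechet_derivative_at[symmetric])
  with Suc D show ?case by (auto simp: differentiable_def)
qed

text \<open>The derivative is a sum of two terms of the same bilinear form in other maps, hence the
  induction over all \<open>f\<close> and \<open>g\<close>.\<close>

lemma Ck_on_bounded_bilinear:
  assumes h: "bounded_bilinear h"
  shows "Ck_on k f UNIV \<Longrightarrow> Ck_on k g UNIV \<Longrightarrow> Ck_on k (\<lambda>x. h (f x) (g x)) UNIV"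
proof (induction k arbitrary: f g)
  case 0
  then show ?case by (simp add: bounded_bilinear.continuous_on[OF h])
next
  case (Suc k)
  have d: "f differentiable at x" "g differentiable at x" for x
    using Suc.prems by simp_all
  have D: "((\<lambda>x. h (f x) (g x)) has_derivative
      (\<lambda>v. h (f x) (frechet_derivative g (at x) v) + h (frechet_derivative f (at x) v) (g x))) (at x)"
    for x
    by (intro bounded_bilinear.FDERIV[OF h] d[unfolded frechet_derivative_works])
  then have eq: "frechet_derivative (\<lambda>x. h (f x) (g x)) (at x) =
      (\<lambda>v. h (f x) (frechet_derivative g (at x) v) + h (frechet_derivative f (at x) v) (g x))" for x
    by (rule frechet_derivative_at[symmetric])
  have "Ck_on k (\<lambda>x. frechet_derivative f (at x) v) UNIV"
    "Ck_on k (\<lambda>x. frechet_derivative g (at x) v) UNIV" for v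
    using Suc.prems by simp_all
  then have "Ck_on k (\<lambda>x. h (f x) (frechet_derivative g (at x) v) +
      h (frechet_derivative f (at x) v) (g x)) UNIV" for v
    by (intro Ck_on_add Suc.IH Ck_on_SucD[OF Suc.prems(1)] Ck_on_SucD[OF Suc.prems(2)])
  with D show ?case by (auto simp: differentiable_def eq)
qed

section \<open>Closure rules for smooth maps\<close>

named_theorems smooth_intros

lemma smooth_const [smooth_intros]: "smooth (\<lambda>x. c)"
  by (simp add: smooth_def Ck_on_const)

lemma smooth_ident [smooth_intros]: "smooth (\<lambda>x. x)"
  by (simp add: smooth_def Ck_on_ident)

lemma smooth_add [smooth_intros]: "smooth f \<Longrightarrow> smooth g \<Longrightarrow> smooth (\<lambda>x. f x + g x)"
  by (simp add: smooth_def Ck_on_add)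

lemma smooth_linear: "linear L \<Longrightarrow> smooth f \<Longrightarrow> smooth (\<lambda>x. L (f x))"
  by (simp add: smooth_def Ck_on_bounded_linear linear_conv_bounded_linear)

lemma smooth_bilinear:
  "bounded_bilinear h \<Longrightarrow> smooth f \<Longrightarrow> smooth g \<Longrightarrow> smooth (\<lambda>x. h (f x) (g x))"
  by (simp add: smooth_def Ck_on_bounded_bilinear)

lemma smooth_minus [smooth_intros]: "smooth f \<Longrightarrow> smooth (\<lambda>x. - f x)"
  by (rule smooth_linear[where L = uminus]) (auto intro!: linearI)

lemma smooth_diff [smooth_intros]: "smooth f \<Longrightarrow> smooth g \<Longrightarrow> smooth (\<lambda>x. f x - g x)"
  using smooth_add[OF _ smooth_minus] by fastforce

lemma smooth_scaleR [smooth_intros]: "smooth f \<Longrightarrow> smooth g \<Longrightarrow> smooth (\<lambda>x. f x *\<^sub>R g x)"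
  by (rule smooth_bilinear[OF bounded_bilinear_scaleR])

lemma smooth_inner [smooth_intros]: "smooth f \<Longrightarrow> smooth g \<Longrightarrow> smooth (\<lambda>x. inner (f x) (g x))"
  by (rule smooth_bilinear[OF bounded_bilinear_inner])

lemma smooth_mult [smooth_intros]:
  "smooth f \<Longrightarrow> smooth g \<Longrightarrow> smooth (\<lambda>x. f x * (g x :: 'a::cayley_dickson))"
  by (rule smooth_bilinear)
    (auto simp: bilinear_def cd_mult_simps intro!: linearI simp flip: bilinear_conv_bounded_bilinear)

lemma smooth_fst [smooth_intros]: "smooth f \<Longrightarrow> smooth (\<lambda>x. fst (f x))"
  by (rule smooth_linear[OF linear_fst])

lemma smooth_snd [smooth_intros]: "smooth f \<Longrightarrow> smooth (\<lambda>x. snd (f x))"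
  by (rule smooth_linear[OF linear_snd])

lemma smooth_cd1 [smooth_intros]: "smooth f \<Longrightarrow> smooth (\<lambda>x. cd1 (f x))"
  by (rule smooth_linear) (auto intro!: linearI)

lemma smooth_cd2 [smooth_intros]: "smooth f \<Longrightarrow> smooth (\<lambda>x. cd2 (f x))"
  by (rule smooth_linear) (auto intro!: linearI)

lemma smooth_vec_nth [smooth_intros]:
  "smooth f \<Longrightarrow> smooth (\<lambda>x. (f x :: real ^ 'n) $ i)"
  by (rule smooth_linear) (auto intro!: linearI)

lemma smooth_Pair [smooth_intros]: "smooth f \<Longrightarrow> smooth g \<Longrightarrow> smooth (\<lambda>x. (f x, g x))"
proof -
  assume "smooth f" "smooth g"
  then have "smooth (\<lambda>x. (f x, 0) + (0, g x))"
    by (intro smooth_add smooth_linear[where L = "\<lambda>a. (a, 0)"] smooth_linear[where L = "\<lambda>a. (0, a)"])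
      (auto intro!: linearI)
  then show ?thesis by simp
qed

lemma smooth_CD [smooth_intros]: "smooth f \<Longrightarrow> smooth g \<Longrightarrow> smooth (\<lambda>x. CD (f x) (g x))"
proof -
  assume "smooth f" "smooth g"
  then have "smooth (\<lambda>x. CD (f x) 0 + CD 0 (g x))"
    by (intro smooth_add smooth_linear[where L = "\<lambda>a. CD a 0"] smooth_linear[where L = "\<lambda>a. CD 0 a"])
      (auto intro!: linearI simp: cd_eq_iff)
  then show ?thesis by (simp add: plus_cd_def)
qed

lemma smooth_imp_smooth_map_on: "smooth f \<Longrightarrow> smooth_map_on S f"
  unfolding smooth_map_on_def smooth_def by (intro ballI exI[of _ UNIV] exI[of _ f]) auto

section \<open>The diffeomorphism\<close>

text \<open>In order, the projections of \<open>e\<close> stand for \<open>x\<close>,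
  \<open>y\<close>, for \<open>u\<close>, \<open>v\<close> and for the coordinates \<open>s\<close>,
  \<open>t\<close> of the trivial summand. Projections instead of patterns let
  \<open>smooth_intros\<close> apply directly.\<close>

definition to_D :: "(A3 \<times> A3) \<times> (A4 \<times> (real ^ 2)) \<Rightarrow> A5"
  where "to_D e = brace (unit_pair (fst (fst e)) (snd (fst e)))
    (unit_pair
      (sqrt 2 *\<^sub>R cd1 (fst (snd e)) + (snd (snd e) $ 1) *\<^sub>R fst (fst e) + (snd (snd e) $ 2) *\<^sub>R snd (fst e))
      ((snd (snd e) $ 2) *\<^sub>R fst (fst e) - (snd (snd e) $ 1) *\<^sub>R snd (fst e) - sqrt 2 *\<^sub>R cd2 (fst (snd e))))"

text \<open>Solves the formulas for \<open>z\<close> and \<open>w\<close>: the inner products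
  recover \<open>s\<close> and \<open>t\<close>, and what remains is \<open>sqrt 2\<close> times
  \<open>u\<close> and \<open>v\<close>.\<close>

definition of_pairs :: "A4 \<Rightarrow> A4 \<Rightarrow> (A3 \<times> A3) \<times> (A4 \<times> (real ^ 2))"
  where "of_pairs a b = ((cd1 a, cd2 a),
    ((1 / sqrt 2) *\<^sub>R
      CD (cd1 b - inner (cd1 b) (cd1 a) *\<^sub>R cd1 a - inner (cd1 b) (cd2 a) *\<^sub>R cd2 a)
         (inner (cd1 b) (cd2 a) *\<^sub>R cd1 a - inner (cd1 b) (cd1 a) *\<^sub>R cd2 a - cd2 b),
     inner (cd1 b) (cd1 a) *\<^sub>R axis 1 1 + inner (cd1 b) (cd2 a) *\<^sub>R axis 2 1))"

text \<open>The factor \<open>sqrt 2\<close> produced by \<open>brace_decode\<close> cancels the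
  normalization in \<open>unit_pair\<close>, so the arguments are the frames themselves.\<close>

definition from_D :: "A5 \<Rightarrow> (A3 \<times> A3) \<times> (A4 \<times> (real ^ 2))"
  where "from_D E = of_pairs (cd1 E + cd_i * cd2 E) (cd1 E - cd_i * cd2 E)"

lemma smooth_to_D: "smooth to_D"
  unfolding to_D_def brace_def unit_pair_def by (intro smooth_intros)

lemma smooth_from_D: "smooth from_D"
  unfolding from_D_def of_pairs_def by (intro smooth_intros)

lemma from_D_brace: "from_D (brace (unit_pair x y) (unit_pair z w)) = of_pairs (CD x y) (CD z w)"
  by (simp add: from_D_def brace_decode unit_pair_def)

lemma mem_sphere_bundle_iff:
  "((x, y), (CD u v, t)) \<in>
      sphere_bundle V2_R7 (whitney_sum xi (trivial_bundle :: A3 \<times> A3 \<Rightarrow> (real ^ 2) set)) \<longleftrightarrow>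
    oct_frame x y \<and> CD u v \<in> Ann (CD x y) \<and> inner u u + inner v v + (t $ 1)\<^sup>2 + (t $ 2)\<^sup>2 = 1"
  by (simp add: sphere_bundle_def V2_R7_iff whitney_sum_def trivial_bundle_def xi_def norm_eq_1
    inner_prod_def inner_CD inner_vec_def sum_2 power2_eq_square add.assoc)

lemma vec2_eq: "t = (t $ 1) *\<^sub>R axis 1 1 + (t $ 2) *\<^sub>R axis 2 (1 :: real)" for t :: "real ^ 2"
  by (simp add: vec_eq_iff forall_2 axis_def)

lemma to_D_mem:
  assumes "oct_frame x y" "CD u v \<in> Ann (CD x y)" "inner u u + inner v v + (t $ 1)\<^sup>2 + (t $ 2)\<^sup>2 = 1"
  obtains z w where "oct_frame z w" "x * z + y * w = 0"
    "to_D ((x, y), (CD u v, t)) = brace (unit_pair x y) (unit_pair z w)"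
    "of_pairs (CD x y) (CD z w) = ((x, y), (CD u v, t))"
proof -
  define z w where "z = sqrt 2 *\<^sub>R u + (t $ 1) *\<^sub>R x + (t $ 2) *\<^sub>R y"
    and "w = (t $ 2) *\<^sub>R x - (t $ 1) *\<^sub>R y - sqrt 2 *\<^sub>R v"
  \<comment> \<open>Elements of the annihilator have halves of equal norm, so the scaling by
    \<open>sqrt 2\<close> makes \<open>z\<close> a unit vector exactly on the unit sphere of the
    fiber.\<close>
  have "(sqrt 2)\<^sup>2 * inner u u + (t $ 1)\<^sup>2 + (t $ 2)\<^sup>2 = 1"
    using assms(3) Ann_oct_frame_facts(8)[OF assms(1,2)] by simp
  note zw = oct_frame_of_Ann[OF assms(1,2) this, folded z_def w_def]
  have "of_pairs (CD x y) (CD z w) = ((x, y), (CD u v, t))"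
  proof -
    have "z - (t $ 1) *\<^sub>R x - (t $ 2) *\<^sub>R y = sqrt 2 *\<^sub>R u"
      "(t $ 2) *\<^sub>R x - (t $ 1) *\<^sub>R y - w = sqrt 2 *\<^sub>R v"
      by (simp_all add: z_def w_def)
    then show ?thesis
      by (simp add: of_pairs_def zw(3,4) scaleR_CD flip: vec2_eq)
  qed
  with zw show ?thesis
    by (intro that[of z w]) (simp_all add: to_D_def z_def w_def)
qed

lemma of_pairs_mem:
  assumes f: "oct_frame x y" and g: "oct_frame z w" and R: "x * z + y * w = 0"
  obtains u v t where "of_pairs (CD x y) (CD z w) = ((x, y), (CD u v, t))"
    "CD u v \<in> Ann (CD x y)" "inner u u + inner v v + (t $ 1)\<^sup>2 + (t $ 2)\<^sup>2 = 1"
    "to_D ((x, y), (CD u v, t)) = brace (unit_pair x y) (unit_pair z w)"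
proof -
  define s t where "s = inner z x" and "t = inner z y"
  define u v where "u = (1 / sqrt 2) *\<^sub>R (z - s *\<^sub>R x - t *\<^sub>R y)"
    and "v = (1 / sqrt 2) *\<^sub>R (t *\<^sub>R x - s *\<^sub>R y - w)"
  define c :: "real ^ 2" where "c = s *\<^sub>R axis 1 1 + t *\<^sub>R axis 2 1"
  have c: "c $ 1 = s" "c $ 2 = t" by (simp_all add: c_def axis_def)
  have "CD (z - s *\<^sub>R x - t *\<^sub>R y) (t *\<^sub>R x - s *\<^sub>R y - w) \<in> Ann (CD x y)"
    unfolding s_def t_def
    by (rule Ann_of_oct_frame[OF f g oct_frames_C_orthogonal[OF f g R] oct_frames_orthogonal_Ann[OF f R]])
  then have "(1 / sqrt 2) *\<^sub>R CD (z - s *\<^sub>R x - t *\<^sub>R y) (t *\<^sub>R x - s *\<^sub>R y - w) \<in> Ann (CD x y)"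
    by (simp add: Ann_def cd_mult_scaleR)
  moreover have uv: "(1 / sqrt 2) *\<^sub>R CD (z - s *\<^sub>R x - t *\<^sub>R y) (t *\<^sub>R x - s *\<^sub>R y - w) = CD u v"
    by (simp add: scaleR_CD u_def v_def)
  ultimately have A: "CD u v \<in> Ann (CD x y)" by simp
  note n = oct_frame_inner[OF f] and m = oct_frame_inner[OF g]
  have "inner x z = s" "inner y z = t" by (simp_all add: s_def t_def inner_commute)
  \<comment> \<open>The unit vector \<open>z\<close> has components \<open>s\<close> and
    \<open>t\<close> along \<open>x\<close> and \<open>y\<close>; its remaining part is
    \<open>sqrt 2\<close> times \<open>u\<close>. Equality of the norms of \<open>u\<close> and
    \<open>v\<close> then gives the sphere equation.\<close>
  then have "2 * inner u u + s\<^sup>2 + t\<^sup>2 = 1"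
    by (simp add: u_def inner_diff_left inner_diff_right n m s_def[symmetric] t_def[symmetric]
      power2_eq_square algebra_simps)
  then have "inner u u + inner v v + (c $ 1)\<^sup>2 + (c $ 2)\<^sup>2 = 1"
    using Ann_oct_frame_facts(8)[OF f A] by (simp add: c)
  moreover have "of_pairs (CD x y) (CD z w) = ((x, y), (CD u v, c))"
    by (simp add: of_pairs_def uv c_def flip: s_def t_def)
  moreover have "to_D ((x, y), (CD u v, c)) = brace (unit_pair x y) (unit_pair z w)"
    by (simp add: to_D_def c u_def v_def)
  ultimately show ?thesis using A that by blast
qed

theorem theorem7p5:
  fixes X :: "A5 set"
  assumes "X = {brace a b | a b. a \<in> cd_C\<^sup>\<bottom> \<and> b \<in> cd_C\<^sup>\<bottom> \<and> brace a b \<in> D_locus \<and>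
    zero_divisor a \<and> norm a = 1 \<and> zero_divisor b \<and> norm b = 1}"
  shows "diffeomorphic X
    (sphere_bundle V2_R7 (whitney_sum xi (trivial_bundle :: A3 \<times> A3 \<Rightarrow> (real^2) set)))"
proof -
  let ?Y = "sphere_bundle V2_R7 (whitney_sum xi (trivial_bundle :: A3 \<times> A3 \<Rightarrow> (real^2) set))"
  note X = assms[unfolded D_locus_unit_zero_divisors_eq]
  have from_D: "from_D E \<in> ?Y \<and> to_D (from_D E) = E" if "E \<in> X" for E
  proof -
    from that obtain x y z w where f: "oct_frame x y" "oct_frame z w" "x * z + y * w = 0"
      and E: "E = brace (unit_pair x y) (unit_pair z w)"
      unfolding X by blast
    obtain u v t where "of_pairs (CD x y) (CD z w) = ((x, y), (CD u v, t))"
      "CD u v \<in> Ann (CD x y)" "inner u u + inner v v + (t $ 1)\<^sup>2 + (t $ 2)\<^sup>2 = 1"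
      "to_D ((x, y), (CD u v, t)) = brace (unit_pair x y) (unit_pair z w)"
      by (rule of_pairs_mem[OF f])
    with f show ?thesis by (simp add: E from_D_brace mem_sphere_bundle_iff)
  qed
  have to_D: "to_D e \<in> X \<and> from_D (to_D e) = e" if "e \<in> ?Y" for e
  proof -
    obtain x y u v t where e: "e = ((x, y), (CD u v, t))"
      by (metis cd.exhaust surj_pair)
    then have f: "oct_frame x y" "CD u v \<in> Ann (CD x y)"
      "inner u u + inner v v + (t $ 1)\<^sup>2 + (t $ 2)\<^sup>2 = 1"
      using that by (simp_all add: mem_sphere_bundle_iff)
    then obtain z w where zw: "oct_frame z w" "x * z + y * w = 0"
      "to_D e = brace (unit_pair x y) (unit_pair z w)" "of_pairs (CD x y) (CD z w) = e"
      unfolding e by (rule to_D_mem)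
    have "to_D e \<in> X" unfolding zw(3) X using f(1) zw(1,2) by blast
    then show ?thesis by (simp add: zw(3,4) from_D_brace)
  qed
  show ?thesis
    unfolding diffeomorphic_def
  proof (intro exI conjI ballI)
    show "smooth_map_on X from_D" "smooth_map_on ?Y to_D"
      by (intro smooth_imp_smooth_map_on smooth_from_D smooth_to_D)+
    show "from_D ` X = ?Y" "to_D ` ?Y = X"
      using from_D to_D by (auto simp: image_iff) metis+
  qed (use from_D to_D in auto)
qed

end
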